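(* Let $(G,\tau)$ be a metrizable, locally quasi-convex, bounded abelian topological group, and let $\mathcal{C}(G,\tau)$ be the set of all locally quasi-convex group topologies on $G$ compatible with $\tau$. Then: 1. $|\mathcal{C}(G,\tau)|=1$ if and only if $\tau$ is precompact. In this case, $(G,\tau)$ is precompact and Mackey. 2. Otherwise, $|\mathcal{C}(G,\tau)|\ge 2^{\mathfrak{c}}$. In this case, $\tau$ is the only metrizable topology in $\mathcal{C}(G,\tau)$.
   Context: $\mathfrak{c}$ is the cardinality of the continuum. $\mathbb{T}$ is the unit circle group in $\mathbb{C}$ and $\mathbb{T}_+=\{z\in\mathbb{T}:\mathrm{Re}(z)\ge 0\}$. An abelian group $G$ is bounded if there is a positive integer $m$ with $mG=\{0\}$. For a topological abelian group $(G,\tau)$, the dual group $(G,\tau)^\wedge$ is the group of all continuous homomorphisms $(G,\tau)\to\mathbb{T}$. A subset $M\subseteq G$ is quasi-convex if for every $x\in G\setminus M$ there is $\phi\in (G,\tau)^\wedge$ with $\phi(M)\subseteq\mathbb{T}_+$ and $\phi(x)\notin\mathbb{T}_+$. The topology $\tau$ is locally quasi-convex if it has a basis of neighborhoods of $0$ consisting of quasi-convex sets; locally quasi-convex group topologies are taken to be Hausdorff. Two group topologies $\tau,\nu$ on $G$ are compatible if $(G,\tau)^\wedge=(G,\nu)^\wedge$. A locally quasi-convex group topology $\tau$ on $G$ is Mackey if $\nu\le\tau$ (that is, $\nu\subseteq\tau$) for every $\nu\in\mathcal{C}(G,\tau)$. A group topology is precompact if for every neighborhood $U$ of $0$ there is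 a finite $F\subseteq G$ with $F+U=G$. *)

theory Defs
  imports "HOL-Analysis.Analysis"
begin

text \<open>
  The abelian group is the whole type \<open>'a::ab_group_add\<close>; a topology on it is a value of type
  \<open>'a topology\<close> with full \<open>topspace\<close>, so that different topologies on the same group can be
  compared.
\<close>

definition group_topology :: "'a::ab_group_add topology \<Rightarrow> bool" where
  "group_topology \<tau> \<longleftrightarrow>
     topspace \<tau> = UNIV \<and>
     continuous_map (prod_topology \<tau> \<tau>) \<tau> (\<lambda>(x, y). x + y) \<and>
     continuous_map \<tau> \<tau> uminus"

text \<open>The sum below is the multiple \<open>m x\<close>.\<close>

definition bounded_group :: "'a::ab_group_add itself \<Rightarrow> bool" where
  "bounded_group _ \<longleftrightarrow> (\<exists>m::nat. m > 0 \<and> (\<forall>x::'a. (\<Sum>i<m. x) = 0))"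

abbreviation circle :: "complex set" where
  "circle \<equiv> sphere 0 1"

definition circle_plus :: "complex set" where
  "circle_plus = {z \<in> circle. Re z \<ge> 0}"

text \<open>
  The underlying set of the dual group. Its group operation is always pointwise multiplication,
  so two duals are equal as groups if and only if these sets are equal.
\<close>

definition dual_group :: "'a::ab_group_add topology \<Rightarrow> ('a \<Rightarrow> complex) set" where
  "dual_group \<tau> =
     {\<phi>. continuous_map \<tau> (top_of_set circle) \<phi> \<and> (\<forall>x y. \<phi> (x + y) = \<phi> x * \<phi> y)}"

definition quasi_convex :: "'a::ab_group_add topology \<Rightarrow> 'a set \<Rightarrow> bool" where
  "quasi_convex \<tau> M \<longleftrightarrow>
     (\<forall>x. x \<notin> M \<longrightarrow> (\<exists>\<phi>\<in>dual_group \<tau>. \<phi> ` M \<subseteq> circle_plus \<and> \<phi> x \<notin> circle_plus))"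

text \<open>Quasi-convex neighborhoods are not required to be open.\<close>

definition lqc_group_topology :: "'a::ab_group_add topology \<Rightarrow> bool" where
  "lqc_group_topology \<tau> \<longleftrightarrow>
     group_topology \<tau> \<and> Hausdorff_space \<tau> \<and> neighbourhood_base_at 0 (quasi_convex \<tau>) \<tau>"

definition compatible :: "'a::ab_group_add topology \<Rightarrow> 'a topology \<Rightarrow> bool" where
  "compatible \<tau> \<nu> \<longleftrightarrow> dual_group \<tau> = dual_group \<nu>"

definition compatible_lqc_topologies :: "'a::ab_group_add topology \<Rightarrow> 'a topology set" where
  "compatible_lqc_topologies \<tau> = {\<nu>. lqc_group_topology \<nu> \<and> compatible \<tau> \<nu>}"

definition mackey_topology :: "'a::ab_group_add topology \<Rightarrow> bool" where
  "mackey_topology \<tau> \<longleftrightarrow>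
     lqc_group_topology \<tau> \<and>
     (\<forall>\<nu>\<in>compatible_lqc_topologies \<tau>. \<forall>U. openin \<nu> U \<longrightarrow> openin \<tau> U)"

definition precompact_topology :: "'a::ab_group_add topology \<Rightarrow> bool" where
  "precompact_topology \<tau> \<longleftrightarrow>
     group_topology \<tau> \<and>
     (\<forall>U. openin \<tau> U \<and> 0 \<in> U \<longrightarrow> (\<exists>F. finite F \<and> {f + u |f u. f \<in> F \<and> u \<in> U} = UNIV))"

end

theory Submission
  imports Defs
begin

text \<open>
  On a bounded group every character takes values in a finite group of roots of unity, so a locally
  quasi-convex topology has a base at \<open>0\<close> of open subgroups \<open>kern K\<close>, with \<open>K\<close> a set of continuous
  characters. If \<open>\<tau>\<close> is metrizable and \<open>kern K\<close> is open in a compatible topology but not in \<open>\<tau>\<close>,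
  there are a \<open>\<tau>\<close>-null sequence \<open>y\<close> and a biorthogonal sequence \<open>\<xi>\<close> of characters vanishing on
  \<open>kern K\<close>; a pointwise cluster point of the partial products of \<open>\<xi>\<close> is continuous for the compatible
  topology but not for \<open>\<tau>\<close>, a contradiction. Hence \<open>\<tau>\<close> is Mackey. If \<open>\<tau>\<close> is precompact, it is the
  weak topology of its dual and so also the coarsest compatible one. If \<open>\<tau>\<close> is not precompact, some
  \<open>kern K\<close> has infinite index and again carries a biorthogonal sequence. For a set \<open>S\<close> of
  reals, add to the weak topology the open subgroups \<open>kern (\<xi> ` A r)\<close>, \<open>r \<in> S\<close>, where
  the \<open>A r\<close> are almost disjoint infinite sets of naturals; different \<open>S\<close> give different topologies.
\<close>

section \<open>Characters\<close>

definition character :: "('a::ab_group_add \<Rightarrow> complex) \<Rightarrow> bool" where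
  "character \<phi> \<longleftrightarrow> (\<forall>x. norm (\<phi> x) = 1) \<and> (\<forall>x y. \<phi> (x + y) = \<phi> x * \<phi> y)"

definition kern :: "('a::ab_group_add \<Rightarrow> complex) set \<Rightarrow> 'a set" where
  "kern K = {x. \<forall>\<phi>\<in>K. \<phi> x = 1}"

lemma character_add: "character \<phi> \<Longrightarrow> \<phi> (x + y) = \<phi> x * \<phi> y"
  by (simp add: character_def)

lemma character_nz: "character \<phi> \<Longrightarrow> \<phi> x \<noteq> 0"
  by (metis character_def norm_zero zero_neq_one)

lemma character_0: "character \<phi> \<Longrightarrow> \<phi> 0 = 1"
  by (metis add_0 character_add character_nz mult_cancel_left2)

lemma character_minus: "character \<phi> \<Longrightarrow> \<phi> (- x) = inverse (\<phi> x)"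
  by (metis add.right_inverse character_0 character_add inverse_unique)

lemma character_diff: "character \<phi> \<Longrightarrow> \<phi> (x - y) = \<phi> x / \<phi> y"
  by (metis add_uminus_conv_diff character_add character_minus divide_inverse)

lemma character_multiple: "character \<phi> \<Longrightarrow> \<phi> (\<Sum>i<(j::nat). x) = \<phi> x ^ j"
  by (induction j) (auto simp: character_0 character_add mult.commute)

lemma character_one: "character (\<lambda>_. 1)"
  by (simp add: character_def)

lemma character_mult: "character \<phi> \<Longrightarrow> character \<psi> \<Longrightarrow> character (\<lambda>x. \<phi> x * \<psi> x)"
  by (simp add: character_def norm_mult)

lemma character_diff_eq_1: "character \<phi> \<Longrightarrow> \<phi> (x - y) = 1 \<longleftrightarrow> \<phi> x = \<phi> y"
  by (simp add: character_diff character_nz)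

lemma bounded_group_root_of_unity:
  assumes "bounded_group TYPE('a::ab_group_add)"
  obtains m :: nat where "m > 0" "\<And>(\<phi>::'a \<Rightarrow> complex) x. character \<phi> \<Longrightarrow> \<phi> x ^ m = 1"
  using assms unfolding bounded_group_def by (metis character_0 character_multiple)

lemma kern_0: "(\<And>\<phi>. \<phi> \<in> K \<Longrightarrow> character \<phi>) \<Longrightarrow> 0 \<in> kern K"
  by (auto simp: kern_def character_0)

lemma kern_add: "(\<And>\<phi>. \<phi> \<in> K \<Longrightarrow> character \<phi>) \<Longrightarrow> x \<in> kern K \<Longrightarrow> y \<in> kern K \<Longrightarrow> x + y \<in> kern K"
  by (auto simp: kern_def character_add)

lemma kern_minus: "(\<And>\<phi>. \<phi> \<in> K \<Longrightarrow> character \<phi>) \<Longrightarrow> x \<in> kern K \<Longrightarrow> - x \<in> kern K"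
  by (auto simp: kern_def character_minus)

lemma kern_multiple:
  "(\<And>\<phi>. \<phi> \<in> K \<Longrightarrow> character \<phi>) \<Longrightarrow> x \<in> kern K \<Longrightarrow> (\<Sum>i<(j::nat). x) \<in> kern K"
  by (auto simp: kern_def character_multiple)

lemma kern_Un: "kern (K \<union> L) = kern K \<inter> kern L"
  by (auto simp: kern_def)

text \<open>If \<open>z \<noteq> 1\<close>, the powers \<open>z ^ j\<close> with
  \<open>j < m\<close> sum to 0. Their real parts are nonnegative, so all vanish, but
  \<open>z ^ 0\<close> has real part 1.\<close>

lemma circle_plus_powers_imp_1:
  assumes "z ^ m = 1" "m > 0" "\<And>j. j < m \<Longrightarrow> z ^ j \<in> circle_plus"
  shows "z = 1"
proof (rule ccontr)
  assume "z \<noteq> 1"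
  then have "(\<Sum>j<m. z ^ j) = 0"
    using assms(1) by (simp add: geometric_sum)
  then have "(\<Sum>j<m. Re (z ^ j)) = 0"
    by (metis Re_sum zero_complex.sel(1))
  moreover have "\<And>j. j < m \<Longrightarrow> Re (z ^ j) \<ge> 0"
    using assms(3) by (auto simp: circle_plus_def)
  ultimately have "Re (z ^ 0) = 0"
    using assms(2) by (metis (no_types, lifting) finite_lessThan lessThan_iff sum_nonneg_eq_0_iff)
  then show False by simp
qed

text \<open>The values on \<open>C\<close> form a function into the finite set of
  \<open>m\<close>-th roots of unity; restricting it to \<open>C\<close> leaves only finitely many
  such functions.\<close>

lemma finite_range_of_characters:
  fixes C :: "('a::ab_group_add \<Rightarrow> complex) set"
  assumes "bounded_group TYPE('a)" "finite C" "\<And>\<phi>. \<phi> \<in> C \<Longrightarrow> character \<phi>"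
  shows "finite (range (\<lambda>x. \<lambda>\<phi>\<in>C. \<phi> x))"
proof -
  obtain m :: nat where m: "m > 0" "\<And>(\<phi>::'a \<Rightarrow> complex) x. character \<phi> \<Longrightarrow> \<phi> x ^ m = 1"
    using bounded_group_root_of_unity[OF assms(1)] by blast
  have "range (\<lambda>x. \<lambda>\<phi>\<in>C. \<phi> x) \<subseteq> C \<rightarrow>\<^sub>E {z. z ^ m = 1}"
    using m assms(3) by auto
  moreover have "finite (C \<rightarrow>\<^sub>E {z::complex. z ^ m = 1})"
    using m assms(2) by (intro finite_PiE finite_nth_roots) auto
  ultimately show ?thesis
    by (rule finite_subset)
qed

text \<open>Points with equal values on \<open>C\<close> differ by an element of
  \<open>kern C\<close>, so one representative per value tuple suffices.\<close>

lemma finite_index_kern: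
  fixes C :: "('a::ab_group_add \<Rightarrow> complex) set"
  assumes "bounded_group TYPE('a)" "finite C" "\<And>\<phi>. \<phi> \<in> C \<Longrightarrow> character \<phi>"
  obtains F where "finite F" "\<And>x. \<exists>f\<in>F. x - f \<in> kern C"
proof -
  obtain F where F: "finite F" "range (\<lambda>x. \<lambda>\<phi>\<in>C. \<phi> x) = (\<lambda>x. \<lambda>\<phi>\<in>C. \<phi> x) ` F"
    using finite_subset_image[OF finite_range_of_characters[OF assms] order_refl] by blast
  have "\<exists>f\<in>F. x - f \<in> kern C" for x
  proof -
    obtain f where "f \<in> F" "(\<lambda>\<phi>\<in>C. \<phi> x) = (\<lambda>\<phi>\<in>C. \<phi> f)"
      using F(2) by blast
    then have "\<And>\<phi>. \<phi> \<in> C \<Longrightarrow> \<phi> x = \<phi> f"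
      by (metis restrict_apply')
    then show ?thesis
      using \<open>f \<in> F\<close> assms(3) by (auto simp: kern_def character_diff_eq_1)
  qed
  then show ?thesis using F(1) that by blast
qed

section \<open>Group topologies on bounded groups\<close>

lemma group_topology_translation:
  assumes "group_topology \<tau>"
  shows "continuous_map \<tau> \<tau> (\<lambda>x. x - a)"
proof -
  have "continuous_map \<tau> (prod_topology \<tau> \<tau>) (\<lambda>x. (x, - a))"
    using assms by (auto simp: continuous_map_pairwise o_def group_topology_def)
  then have "continuous_map \<tau> \<tau> ((\<lambda>(x, y). x + y) \<circ> (\<lambda>x. (x, - a)))"
    using assms continuous_map_compose unfolding group_topology_def by blast
  then show ?thesis by (simp add: o_def)
qed

lemma openin_translate:
  assumes "group_topology \<tau>" "openin \<tau> U"
  shows "openin \<tau> {x. x - a \<in> U}"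
  using openin_continuous_map_preimage[OF group_topology_translation[OF assms(1), of a] assms(2)] assms(1)
  by (simp add: group_topology_def)

lemma group_topology_multiple:
  fixes \<tau> :: "'a::ab_group_add topology"
  assumes "group_topology \<tau>"
  shows "continuous_map \<tau> \<tau> (\<lambda>x. \<Sum>i<(j::nat). x)"
proof (induction j)
  case 0
  then show ?case using assms by (simp add: group_topology_def)
next
  case (Suc j)
  have "continuous_map \<tau> (prod_topology \<tau> \<tau>) (\<lambda>x. ((\<Sum>i<j. x), x))"
    using Suc by (auto simp: continuous_map_pairwise o_def)
  then have "continuous_map \<tau> \<tau> ((\<lambda>(x, y). x + y) \<circ> (\<lambda>x. ((\<Sum>i<j. x), x)))"
    using assms continuous_map_compose unfolding group_topology_def by blast
  then show ?case by (simp add: o_def)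
qed

text \<open>A subgroup containing the open set \<open>V\<close> is the union of the translates of
  \<open>V\<close> by its own elements.\<close>

lemma openin_kern:
  assumes "group_topology \<tau>" "\<And>\<phi>. \<phi> \<in> K \<Longrightarrow> character \<phi>"
    and "openin \<tau> V" "0 \<in> V" "V \<subseteq> kern K"
  shows "openin \<tau> (kern K)"
proof (subst openin_subopen, intro ballI)
  fix x assume x: "x \<in> kern K"
  have "openin \<tau> {y. y - x \<in> V}"
    by (rule openin_translate[OF assms(1,3)])
  moreover have "x \<in> {y. y - x \<in> V}" using assms(4) by simp
  moreover have "{y. y - x \<in> V} \<subseteq> kern K"
  proof
    fix y assume "y \<in> {y. y - x \<in> V}"
    then have "y - x \<in> kern K" using assms(5) by auto
    then show "y \<in> kern K" using kern_add[OF assms(2) _ x, of "y - x"] by simp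
  qed
  ultimately show "\<exists>T. openin \<tau> T \<and> x \<in> T \<and> T \<subseteq> kern K" by blast
qed

lemma dual_group_character: "\<phi> \<in> dual_group \<tau> \<Longrightarrow> topspace \<tau> = UNIV \<Longrightarrow> character \<phi>"
  by (auto simp: dual_group_def character_def continuous_map_def Pi_iff)

text \<open>The values of a character lie in a finite, hence discrete, group of roots of unity. This
  turns continuity into a statement on subgroups.\<close>

lemma dual_group_iff:
  fixes \<tau> :: "'a::ab_group_add topology"
  assumes "bounded_group TYPE('a)" "group_topology \<tau>"
  shows "\<phi> \<in> dual_group \<tau> \<longleftrightarrow> character \<phi> \<and> openin \<tau> (kern {\<phi>})"
proof
  have top: "topspace \<tau> = UNIV" using assms(2) by (simp add: group_topology_def)
  obtain m :: nat where m: "m > 0" "\<And>(\<phi>::'a \<Rightarrow> complex) x. character \<phi> \<Longrightarrow> \<phi> x ^ m = 1"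
    using bounded_group_root_of_unity[OF assms(1)] by blast
  {
    assume \<phi>: "\<phi> \<in> dual_group \<tau>"
    then have char: "character \<phi>" using dual_group_character top by blast
    have "finite {z::complex. z ^ m = 1 \<and> z \<noteq> 1}"
      using finite_nth_roots[of m 1] m(1) by (auto elim: finite_subset[rotated])
    then have "open (- {z::complex. z ^ m = 1 \<and> z \<noteq> 1})"
      by (simp add: finite_imp_closed open_Compl)
    then have "openin (top_of_set circle) (circle \<inter> (- {z::complex. z ^ m = 1 \<and> z \<noteq> 1}))"
      by (simp add: openin_open_Int)
    then have "openin \<tau> {x \<in> topspace \<tau>. \<phi> x \<in> circle \<inter> (- {z::complex. z ^ m = 1 \<and> z \<noteq> 1})}"
      using \<phi> openin_continuous_map_preimage unfolding dual_group_def by blast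
    moreover have "{x \<in> topspace \<tau>. \<phi> x \<in> circle \<inter> (- {z::complex. z ^ m = 1 \<and> z \<noteq> 1})} = kern {\<phi>}"
      using m(2)[OF char] by (auto simp: kern_def top)
    ultimately show "character \<phi> \<and> openin \<tau> (kern {\<phi>})" using char by simp
  next
    assume *: "character \<phi> \<and> openin \<tau> (kern {\<phi>})"
    \<comment> \<open>\<open>U\<close> may be any set, because \<open>\<phi>\<close> is constant on
      the cosets of its open kernel.\<close>
    have "openin \<tau> {x. \<phi> x \<in> U}" for U
    proof (subst openin_subopen, intro ballI)
      fix x assume x: "x \<in> {x. \<phi> x \<in> U}"
      have "openin \<tau> {y. y - x \<in> kern {\<phi>}}"
        using * assms(2) openin_translate by blast
      moreover have "x \<in> {y. y - x \<in> kern {\<phi>}}" "{y. y - x \<in> kern {\<phi>}} \<subseteq> {x. \<phi> x \<in> U}"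
        using * x by (auto simp: kern_def character_diff_eq_1 character_0)
      ultimately show "\<exists>T. openin \<tau> T \<and> x \<in> T \<and> T \<subseteq> {x. \<phi> x \<in> U}" by blast
    qed
    then show "\<phi> \<in> dual_group \<tau>"
      using * by (auto simp: dual_group_def continuous_map_def top character_def)
  }
qed

lemma openin_kern_finite:
  fixes \<tau> :: "'a::ab_group_add topology"
  assumes "bounded_group TYPE('a)" "group_topology \<tau>" "finite C" "C \<subseteq> dual_group \<tau>"
  shows "openin \<tau> (kern C)"
  using assms(3,4)
proof (induction C rule: finite_induct)
  case empty
  have "kern {} = topspace \<tau>" using assms(2) by (simp add: kern_def group_topology_def)
  then show ?case by simp
next
  case (insert \<phi> C)
  then have "openin \<tau> (kern {\<phi>} \<inter> kern C)"
    using dual_group_iff[OF assms(1,2)] by auto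
  then show ?case by (metis insert_is_Un kern_Un)
qed

lemma dual_group_superset_kern:
  fixes \<tau> :: "'a::ab_group_add topology"
  assumes "bounded_group TYPE('a)" "group_topology \<tau>"
    and "openin \<tau> (kern K)" "\<And>\<psi>. \<psi> \<in> K \<Longrightarrow> character \<psi>"
    and "character \<phi>" "kern K \<subseteq> kern {\<phi>}"
  shows "\<phi> \<in> dual_group \<tau>"
  unfolding dual_group_iff[OF assms(1,2)]
  using assms openin_kern[OF assms(2) _ assms(3) kern_0[OF assms(4)], of "{\<phi>}"] by auto

lemma dual_group_one:
  fixes \<tau> :: "'a::ab_group_add topology"
  assumes "group_topology \<tau>"
  shows "(\<lambda>_. 1) \<in> dual_group \<tau>"
  using assms by (simp add: dual_group_def group_topology_def)

lemma dual_group_mult: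
  fixes \<tau> :: "'a::ab_group_add topology"
  assumes "bounded_group TYPE('a)" "group_topology \<tau>" "\<phi> \<in> dual_group \<tau>" "\<psi> \<in> dual_group \<tau>"
  shows "(\<lambda>x. \<phi> x * \<psi> x) \<in> dual_group \<tau>"
proof -
  have c: "character \<phi>" "character \<psi>"
    using assms dual_group_iff by blast+
  show ?thesis
    by (rule dual_group_superset_kern[OF assms(1,2) openin_kern_finite[OF assms(1,2), of "{\<phi>, \<psi>}"]])
      (use c assms in \<open>auto simp: kern_def character_mult\<close>)
qed

lemma dual_group_power:
  fixes \<tau> :: "'a::ab_group_add topology"
  assumes "bounded_group TYPE('a)" "group_topology \<tau>" "\<phi> \<in> dual_group \<tau>"
  shows "(\<lambda>x. \<phi> x ^ (j::nat)) \<in> dual_group \<tau>"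
  by (induction j) (use dual_group_one dual_group_mult assms in auto)

text \<open>Characters of a bounded group take values in the \<open>m\<close>-th roots of unity, and \<open>circle_plus\<close>
  contains no nontrivial subgroup, so a polar of a neighborhood of \<open>0\<close> vanishes on a smaller
  neighborhood.\<close>

lemma lqc_kern_base:
  fixes \<tau> :: "'a::ab_group_add topology"
  assumes "bounded_group TYPE('a)" "lqc_group_topology \<tau>" "openin \<tau> U" "0 \<in> U"
  obtains K where "K \<subseteq> dual_group \<tau>" "openin \<tau> (kern K)" "kern K \<subseteq> U"
proof -
  have gt: "group_topology \<tau>" and top: "topspace \<tau> = UNIV"
    using assms(2) by (auto simp: lqc_group_topology_def group_topology_def)
  obtain m :: nat where m: "m > 0" "\<And>(\<phi>::'a \<Rightarrow> complex) x. character \<phi> \<Longrightarrow> \<phi> x ^ m = 1"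
    using bounded_group_root_of_unity[OF assms(1)] by blast
  obtain V Q where VQ: "openin \<tau> V" "quasi_convex \<tau> Q" "0 \<in> V" "V \<subseteq> Q" "Q \<subseteq> U"
    using assms(2-4) unfolding lqc_group_topology_def neighbourhood_base_at_def by blast
  define K where "K = {\<phi> \<in> dual_group \<tau>. \<phi> ` Q \<subseteq> circle_plus}"
  have K: "\<And>\<phi>. \<phi> \<in> K \<Longrightarrow> character \<phi>"
    using dual_group_character top K_def by blast
  \<comment> \<open>On \<open>W\<close> the multiples \<open>j x\<close> with \<open>j < m\<close>
    stay inside \<open>Q\<close>, so each \<open>\<phi>\<close> in \<open>K\<close> has these powers
    of \<open>\<phi> x\<close> in \<open>circle_plus\<close>.\<close>
  define W where "W = (\<Inter>j\<in>{..<m}. {x. (\<Sum>i<j. x) \<in> V})"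
  have "openin \<tau> {x. (\<Sum>i<(j::nat). x) \<in> V}" for j
    using openin_continuous_map_preimage[OF group_topology_multiple[OF gt, of j] VQ(1)] top by simp
  then have "openin \<tau> W"
    unfolding W_def using m(1) by (intro openin_INT2) auto
  moreover have "0 \<in> W" using VQ by (simp add: W_def)
  moreover have "W \<subseteq> kern K"
  proof
    fix x assume x: "x \<in> W"
    have "\<phi> x = 1" if \<phi>: "\<phi> \<in> K" for \<phi>
    proof (rule circle_plus_powers_imp_1)
      show "\<phi> x ^ m = 1" "m > 0" using m K \<phi> by auto
      fix j assume "j < m"
      then have "(\<Sum>i<j. x) \<in> Q" using x VQ by (auto simp: W_def)
      then have "\<phi> (\<Sum>i<j. x) \<in> circle_plus" using \<phi> K_def by blast
      then show "\<phi> x ^ j \<in> circle_plus" by (simp add: character_multiple K \<phi>)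
    qed
    then show "x \<in> kern K" by (simp add: kern_def)
  qed
  ultimately have "openin \<tau> (kern K)"
    using openin_kern[OF gt K] by blast
  \<comment> \<open>A point outside the quasi-convex set \<open>Q\<close> is separated from it by
    some member of \<open>K\<close>, whose value there cannot be 1.\<close>
  moreover have "kern K \<subseteq> Q"
  proof
    fix x assume "x \<in> kern K"
    moreover have "(1::complex) \<in> circle_plus" by (simp add: circle_plus_def)
    ultimately show "x \<in> Q"
      using VQ(2) unfolding quasi_convex_def K_def kern_def by fastforce
  qed
  ultimately show ?thesis using that[of K] VQ K_def by blast
qed

lemma dual_group_separates:
  fixes \<tau> :: "'a::ab_group_add topology"
  assumes "bounded_group TYPE('a)" "lqc_group_topology \<tau>" "x \<noteq> 0"
  obtains \<phi> where "\<phi> \<in> dual_group \<tau>" "\<phi> x \<noteq> 1"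
proof -
  obtain U where "openin \<tau> U" "0 \<in> U" "x \<notin> U"
    using assms(2,3) unfolding lqc_group_topology_def Hausdorff_space_def group_topology_def
    by (metis UNIV_I disjnt_iff)
  then obtain K where "K \<subseteq> dual_group \<tau>" "kern K \<subseteq> U"
    using lqc_kern_base[OF assms(1,2)] by metis
  then show ?thesis using \<open>x \<notin> U\<close> that by (force simp: kern_def)
qed

text \<open>Translation moves the comparison of two topologies to \<open>0\<close>, where the sets
  \<open>kern K\<close> form a base.\<close>

lemma topology_le_if_kern:
  fixes \<tau> \<nu> :: "'a::ab_group_add topology"
  assumes "bounded_group TYPE('a)" "lqc_group_topology \<nu>" "group_topology \<tau>"
    and "\<And>K. K \<subseteq> dual_group \<nu> \<Longrightarrow> openin \<nu> (kern K) \<Longrightarrow> openin \<tau> (kern K)"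
    and "openin \<nu> U"
  shows "openin \<tau> U"
proof (subst openin_subopen, intro ballI)
  fix x assume x: "x \<in> U"
  have gt: "group_topology \<nu>" and top: "topspace \<nu> = UNIV"
    using assms(2) by (auto simp: lqc_group_topology_def group_topology_def)
  have "openin \<nu> {y. y - (- x) \<in> U}"
    using openin_translate[OF gt assms(5)] by blast
  moreover have "0 \<in> {y. y - (- x) \<in> U}" using x by simp
  ultimately obtain K where K: "K \<subseteq> dual_group \<nu>" "openin \<nu> (kern K)" "kern K \<subseteq> {y. y - (- x) \<in> U}"
    using lqc_kern_base[OF assms(1,2)] by metis
  then have "openin \<tau> {y. y - x \<in> kern K}"
    using assms(3,4) openin_translate by blast
  moreover have "x \<in> {y. y - x \<in> kern K}"
    using kern_0[of K] K(1) dual_group_character top by auto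
  moreover have "{y. y - x \<in> kern K} \<subseteq> U"
    using K(3) by force
  ultimately show "\<exists>T. openin \<tau> T \<and> x \<in> T \<and> T \<subseteq> U" by blast
qed

section \<open>Biorthogonal sequences\<close>

text \<open>An element \<open>z\<close> of prime order \<open>p\<close> has \<open>p\<close>
  distinct powers, which exhaust the \<open>p\<close>-th roots of unity; the inverse of
  \<open>w\<close> is one of them.\<close>

lemma prime_root_of_unity_power:
  fixes z w :: complex
  assumes "prime (p::nat)" "z ^ p = 1" "z \<noteq> 1" "w ^ p = 1"
  obtains e :: nat where "w * z ^ e = 1"
proof -
  have p: "p > 0" using assms(1) prime_gt_0_nat by blast
  have nz: "z \<noteq> 0" using assms(2) p by (auto simp: power_0_left)
  have *: "z ^ i \<noteq> z ^ j" if "i < j" "j < p" for i j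
  proof
    assume "z ^ i = z ^ j"
    then have 1: "z ^ (j - i) = 1"
      using that nz by (simp add: power_diff)
    have "\<not> p dvd j - i" using that by (auto dest: dvd_imp_le)
    then have "coprime (j - i) p"
      using assms(1) prime_imp_coprime coprime_commute by blast
    moreover have "j - i \<noteq> 0" using that by simp
    \<comment> \<open>Bezout makes \<open>z\<close> itself a power of \<open>z ^ (j - i)\<close>,
      which forces \<open>z = 1\<close>.\<close>
    ultimately obtain a b where ab: "(j - i) * a = p * b + 1"
      using bezout_nat[of "j - i" p] by auto
    have "z ^ ((j - i) * a) = 1" using 1 by (simp add: power_mult)
    moreover have "z ^ (p * b + 1) = z" using assms(2) by (simp add: power_mult)
    ultimately show False using ab assms(3) by simp
  qed
  have inj: "inj_on (\<lambda>e. z ^ e) {..<p}"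
    by (rule inj_onI) (metis * lessThan_iff linorder_neqE_nat)
  have "(\<lambda>e. z ^ e) ` {..<p} = {u. u ^ p = 1}"
  proof (rule card_subset_eq)
    show "finite {u::complex. u ^ p = 1}" using p by (intro finite_nth_roots) auto
    show "(\<lambda>e. z ^ e) ` {..<p} \<subseteq> {u. u ^ p = 1}"
      using assms(2) by (auto simp flip: power_mult simp: mult.commute[of _ p] power_mult)
    show "card ((\<lambda>e. z ^ e) ` {..<p}) = card {u::complex. u ^ p = 1}"
      using card_image[OF inj] p by (simp add: card_roots_unity_eq)
  qed
  moreover have "inverse w \<in> {u. u ^ p = 1}" using assms(4) by (simp add: power_inverse)
  ultimately obtain e where "inverse w = z ^ e" by (metis (no_types, lifting) imageE)
  moreover have "w \<noteq> 0" using assms(4) p by (auto simp: power_0_left)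
  ultimately show ?thesis using that by (metis right_inverse)
qed

text \<open>If \<open>k\<close> is the order of \<open>y\<close> modulo \<open>kern Y\<close> and
  \<open>p\<close> is a prime factor of \<open>k\<close>, then the multiple of \<open>y\<close> by
  \<open>k / p\<close> has order \<open>p\<close>.\<close>

lemma multiple_of_prime_order:
  fixes Y :: "('a::ab_group_add \<Rightarrow> complex) set"
  assumes "bounded_group TYPE('a)" "\<And>\<phi>. \<phi> \<in> Y \<Longrightarrow> character \<phi>" "y \<notin> kern Y"
  obtains j p :: nat where "prime p" "(\<Sum>i<j. y) \<notin> kern Y" "\<And>\<phi>. \<phi> \<in> Y \<Longrightarrow> \<phi> (\<Sum>i<j. y) ^ p = 1"
proof -
  obtain m :: nat where m: "m > 0" "\<And>(\<phi>::'a \<Rightarrow> complex) x. character \<phi> \<Longrightarrow> \<phi> x ^ m = 1"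
    using bounded_group_root_of_unity[OF assms(1)] by blast
  define P where "P k \<longleftrightarrow> k > 0 \<and> (\<forall>\<phi>\<in>Y. \<phi> y ^ k = 1)" for k :: nat
  have "P m" using m assms(2) by (auto simp: P_def)
  then obtain k where k: "P k" "\<And>l. P l \<Longrightarrow> k \<le> l"
    by (metis LeastI Least_le)
  have "k \<noteq> 1" using k(1) assms(3) by (auto simp: P_def kern_def)
  then obtain p where p: "prime p" "p dvd k" using prime_factor_nat by blast
  then obtain j where j: "k = p * j" by blast
  have "j > 0" "j < k" using k(1) j prime_gt_1_nat[OF p(1)] by (auto simp: P_def)
  then have "\<not> P j" using k(2) by force
  then have "(\<Sum>i<j. y) \<notin> kern Y"
    using \<open>j > 0\<close> assms(2) by (auto simp: P_def kern_def character_multiple)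
  moreover have "\<phi> (\<Sum>i<j. y) ^ p = 1" if "\<phi> \<in> Y" for \<phi>
    using k(1) that j assms(2) by (simp add: P_def character_multiple mult.commute flip: power_mult)
  ultimately show ?thesis using that p(1) by blast
qed

lemma mult_closed_prod:
  fixes Y :: "('a \<Rightarrow> complex) set"
  assumes "(\<lambda>_. 1) \<in> Y" "\<And>\<phi> \<psi>. \<phi> \<in> Y \<Longrightarrow> \<psi> \<in> Y \<Longrightarrow> (\<lambda>x. \<phi> x * \<psi> x) \<in> Y"
    and "\<And>i. i < n \<Longrightarrow> f i \<in> Y"
  shows "(\<lambda>x. \<Prod>i<(n::nat). f i x ^ (e i::nat)) \<in> Y"
  using assms(3)
proof (induction n)
  case (Suc n)
  have pow: "(\<lambda>x. f n x ^ k) \<in> Y" for k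
    by (induction k) (use Suc.prems assms(1,2) in auto)
  show ?case using Suc assms(2)[OF _ pow] by simp
qed (use assms(1) in simp)

text \<open>The triangular choice \<open>\<xi> i (y n) = 1\<close> for \<open>i < n\<close> can be made biorthogonal: since \<open>y i\<close> has
  prime order modulo \<open>kern Y\<close>, the value \<open>\<psi> (y i)\<close> of a new character is cancelled by a power
  of \<open>\<xi> i\<close>.\<close>

lemma biorthogonal_sequence:
  fixes Y :: "('a::ab_group_add \<Rightarrow> complex) set" and W :: "nat \<Rightarrow> 'a set"
  assumes bdd: "bounded_group TYPE('a)" and char: "\<And>\<phi>. \<phi> \<in> Y \<Longrightarrow> character \<phi>"
    and one: "(\<lambda>_. 1) \<in> Y" and mult: "\<And>\<phi> \<psi>. \<phi> \<in> Y \<Longrightarrow> \<psi> \<in> Y \<Longrightarrow> (\<lambda>x. \<phi> x * \<psi> x) \<in> Y"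
    and W: "\<And>n x (j::nat). x \<in> W n \<Longrightarrow> (\<Sum>i<j. x) \<in> W n"
    and ex: "\<And>n C. finite C \<Longrightarrow> C \<subseteq> Y \<Longrightarrow> \<not> W n \<inter> kern C \<subseteq> kern Y"
  obtains y :: "nat \<Rightarrow> 'a" and \<xi> where "\<And>n. y n \<in> W n" "\<And>n. \<xi> n \<in> Y" "\<And>i j. \<xi> i (y j) = 1 \<longleftrightarrow> i \<noteq> j"
proof -
  \<comment> \<open>The requirement on stage \<open>n\<close>, with \<open>fst r\<close> the point
    and \<open>snd r\<close> the character. The prime exponent is carried along so that later
    characters can be corrected at this point.\<close>
  define P where "P f n r \<longleftrightarrow> fst r \<in> W n \<and> snd r \<in> Y \<and> snd r (fst r) \<noteq> 1 \<and>
      (\<forall>i<n. snd (f i) (fst r) = 1 \<and> snd r (fst (f i)) = 1) \<and>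
      (\<exists>p. prime p \<and> (\<forall>\<phi>\<in>Y. \<phi> (fst r) ^ p = 1))"
    for f :: "nat \<Rightarrow> 'a \<times> ('a \<Rightarrow> complex)" and n :: nat and r
  have "\<exists>f. \<forall>n. P f n (f n)"
  proof (rule dependent_wf_choice)
    show "wf less_than" by simp
    show "P f n r = P g n r" if "\<And>z. (z, n) \<in> less_than \<Longrightarrow> f z = g z" for f g n r
      using that by (auto simp: P_def)
    fix n f assume "\<And>y. (y, n) \<in> less_than \<Longrightarrow> P f y (f y)"
    then have IH: "\<And>i. i < n \<Longrightarrow> P f i (f i)" by simp
    define C where "C = (\<lambda>i. snd (f i)) ` {..<n}"
    have C: "finite C" "C \<subseteq> Y" using IH by (auto simp: C_def P_def)
    \<comment> \<open>All earlier characters kill \<open>y0\<close>, but not all of \<open>Y\<close>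
      does. Passing to a multiple gives prime order and stays in \<open>W n\<close>.\<close>
    then obtain y0 where y0: "y0 \<in> W n" "y0 \<in> kern C" "y0 \<notin> kern Y"
      using ex[of C n] by blast
    obtain j p :: nat where jp: "prime p" "(\<Sum>i<j. y0) \<notin> kern Y" "\<And>\<phi>. \<phi> \<in> Y \<Longrightarrow> \<phi> (\<Sum>i<j. y0) ^ p = 1"
      using multiple_of_prime_order[OF bdd char y0(3)] by metis
    define y where "y = (\<Sum>i<j. y0)"
    have yW: "y \<in> W n" using W y0 y_def by blast
    have "y \<in> kern C" unfolding y_def using C char y0 by (intro kern_multiple) auto
    then have yC: "\<And>i. i < n \<Longrightarrow> snd (f i) y = 1" by (auto simp: C_def kern_def)
    obtain \<psi> where \<psi>: "\<psi> \<in> Y" "\<psi> y \<noteq> 1" using jp(2) by (auto simp: kern_def y_def)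
    have "\<exists>e::nat. \<psi> (fst (f i)) * snd (f i) (fst (f i)) ^ e = 1" if i: "i < n" for i
    proof -
      obtain q where "prime q" "\<forall>\<phi>\<in>Y. \<phi> (fst (f i)) ^ q = 1"
        using IH[OF i] by (auto simp: P_def)
      then obtain k :: nat where "\<psi> (fst (f i)) * snd (f i) (fst (f i)) ^ k = 1"
        using prime_root_of_unity_power[of q "snd (f i) (fst (f i))" "\<psi> (fst (f i))"]
          IH[OF i] \<psi>(1) unfolding P_def by metis
      then show ?thesis by blast
    qed
    then obtain e :: "nat \<Rightarrow> nat" where
      e: "\<And>i. i < n \<Longrightarrow> \<psi> (fst (f i)) * snd (f i) (fst (f i)) ^ e i = 1"
      by metis
    \<comment> \<open>The earlier characters are 1 at \<open>y\<close>, so the correction leaves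
      \<open>\<psi> y\<close> unchanged while it cancels \<open>\<psi>\<close> at the earlier
      points.\<close>
    define \<xi> where "\<xi> = (\<lambda>x. \<psi> x * (\<Prod>i<n. snd (f i) x ^ e i))"
    have "\<xi> \<in> Y"
      unfolding \<xi>_def using IH by (intro mult \<psi> mult_closed_prod one) (auto simp: P_def)
    moreover have "\<xi> y \<noteq> 1"
      using yC \<psi> by (simp add: \<xi>_def)
    moreover have "\<xi> (fst (f k)) = 1" if "k < n" for k
    proof -
      have "snd (f i) (fst (f k)) = 1" if "i < n" "i \<noteq> k" for i
        using IH[of i] IH[of k] that \<open>k < n\<close> by (cases "i < k") (auto simp: P_def)
      then have "(\<Prod>i<n. snd (f i) (fst (f k)) ^ e i) =
          (\<Prod>i<n. if i = k then snd (f k) (fst (f k)) ^ e k else 1)"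
        by (intro prod.cong) auto
      then show ?thesis using e[OF that] that by (simp add: \<xi>_def)
    qed
    ultimately have "P f n (y, \<xi>)"
      using yW yC jp by (auto simp: P_def y_def)
    then show "\<exists>r. P f n r" by blast
  qed
  then obtain f where f: "\<And>n. P f n (f n)" by blast
  have "snd (f i) (fst (f j)) = 1 \<longleftrightarrow> i \<noteq> j" for i j
    using f[of i] f[of j] by (cases i j rule: linorder_cases) (auto simp: P_def)
  then show ?thesis
    using that[of "fst \<circ> f" "snd \<circ> f"] f by (auto simp: P_def)
qed

section \<open>Metrizable topologies are Mackey\<close>

text \<open>The infinite product of the \<open>\<xi> n\<close> need not converge pointwise; \<open>\<phi>\<close> is a cluster point of
  its partial products in the compact power of the circle.\<close>

lemma biorthogonal_product:
  fixes y :: "nat \<Rightarrow> 'a::ab_group_add"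
  assumes "\<And>n. character (\<xi> n)" "\<And>i j. i \<noteq> j \<Longrightarrow> \<xi> i (y j) = 1" "\<And>n. H \<subseteq> kern {\<xi> n}"
  obtains \<phi> where "character \<phi>" "H \<subseteq> kern {\<phi>}" "\<And>n. \<phi> (y n) = \<xi> n (y n)"
proof -
  define S where "S = (UNIV :: 'a set) \<rightarrow>\<^sub>E circle"
  have cont: "continuous_on UNIV (\<lambda>f :: 'a \<Rightarrow> complex. f x)" for x
    by (rule continuous_on_product_coordinates)
  \<comment> \<open>Tychonoff's theorem, then transferred to the type class topology on
    functions.\<close>
  have "compactin (product_topology (\<lambda>_::'a. euclidean :: complex topology) UNIV) S"
    unfolding S_def by (subst compactin_PiE) (simp add: compactin_euclidean_iff)
  then have comp: "compact S"
    by (simp add: euclidean_product_topology compactin_euclidean_iff)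
  \<comment> \<open>These sets are closed and decrease in \<open>n\<close>; a point common to all of
    them and \<open>S\<close> is the desired character.\<close>
  define D where "D n = {f. (\<forall>u v. f (u + v) = f u * f v) \<and> (\<forall>h\<in>H. f h = 1) \<and> (\<forall>i<n. f (y i) = \<xi> i (y i))}" for n :: nat
  have closed: "closed (D n)" for n
    unfolding D_def Ball_def
    by (intro closed_Collect_conj closed_Collect_all closed_Collect_imp closed_Collect_eq
        continuous_intros cont open_Collect_const)
  have "S \<inter> \<Inter> (range D) \<noteq> {}"
  proof (rule compact_imp_fip[OF comp])
    show "\<And>T. T \<in> range D \<Longrightarrow> closed T" using closed by auto
    fix F' assume F': "finite F'" "F' \<subseteq> range D"
    then obtain N where N: "finite N" "F' = D ` N" by (meson finite_subset_image)
    obtain M where M: "\<forall>n\<in>N. n \<le> M" using N(1) finite_nat_set_iff_bounded_le by blast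
    \<comment> \<open>The product of the first \<open>M\<close> characters lies in
      \<open>D n\<close> for all \<open>n \<le> M\<close>, which gives the finite intersection
      property.\<close>
    define \<Phi> where "\<Phi> x = (\<Prod>i<M. \<xi> i x)" for x
    have c: "character \<Phi>"
      using assms(1) by (simp add: character_def \<Phi>_def prod.distrib flip: prod_norm)
    then have "\<Phi> \<in> S" by (auto simp: S_def character_def)
    moreover have "\<Phi> \<in> D n" if "n \<in> N" for n
    proof -
      have "\<Phi> (y k) = \<xi> k (y k)" if "k < M" for k
      proof -
        have "\<Phi> (y k) = (\<Prod>i<M. if i = k then \<xi> k (y k) else 1)"
          unfolding \<Phi>_def using assms(2) by (intro prod.cong) auto
        then show ?thesis using that by simp
      qed
      moreover have "n \<le> M" using M that by blast
      moreover have "\<Phi> h = 1" if "h \<in> H" for h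
        using assms(3) that by (auto simp: \<Phi>_def kern_def intro!: prod.neutral)
      ultimately show ?thesis
        using character_add[OF c] by (auto simp: D_def)
    qed
    ultimately show "S \<inter> \<Inter> F' \<noteq> {}" using N(2) by blast
  qed
  then obtain \<phi> where \<phi>: "\<phi> \<in> S" "\<And>n. \<phi> \<in> D n" by blast
  then have "character \<phi>" by (auto simp: S_def D_def character_def PiE_iff)
  moreover have "H \<subseteq> kern {\<phi>}" using \<phi>(2)[of 0] by (auto simp: D_def kern_def)
  \<comment> \<open>\<open>Suc n\<close> is taken because \<open>D n\<close> constrains only indices
    below \<open>n\<close>.\<close>
  moreover have "\<phi> (y n) = \<xi> n (y n)" for n using \<phi>(2)[of "Suc n"] by (auto simp: D_def)
  ultimately show ?thesis using that by blast
qed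

lemma metrizable_base_at:
  assumes "metrizable_space X" "x \<in> topspace X"
  obtains U :: "nat \<Rightarrow> 'a set" where "\<And>n. openin X (U n)" "\<And>n. x \<in> U n"
    "\<And>V. openin X V \<Longrightarrow> x \<in> V \<Longrightarrow> \<exists>n. U n \<subseteq> V"
proof -
  obtain B where B: "countable B" "\<And>V. V \<in> B \<Longrightarrow> openin X V"
      "\<And>U. openin X U \<Longrightarrow> x \<in> U \<Longrightarrow> \<exists>V. V \<in> B \<and> x \<in> V \<and> V \<subseteq> U"
    using metrizable_imp_first_countable[OF assms(1)] assms(2) unfolding first_countable_def by metis
  \<comment> \<open>Members of \<open>B\<close> need not contain \<open>x\<close>, so those that do
    are selected before enumerating.\<close>
  define B' where "B' = {V \<in> B. x \<in> V}"
  have "countable B'" "B' \<noteq> {}"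
    using B(1) B(3)[of "topspace X"] assms(2) by (auto simp: B'_def)
  then have r: "range (from_nat_into B') = B'" by (rule range_from_nat_into[rotated])
  show ?thesis
  proof (rule that[of "from_nat_into B'"])
    show "openin X (from_nat_into B' n)" "x \<in> from_nat_into B' n" for n
      using from_nat_into[OF \<open>B' \<noteq> {}\<close>, of n] B(2) by (auto simp: B'_def)
    show "\<exists>n. from_nat_into B' n \<subseteq> V" if V: "openin X V" "x \<in> V" for V
    proof -
      obtain V' where "V' \<in> B'" "V' \<subseteq> V" using B(3)[OF V] by (auto simp: B'_def)
      then show ?thesis using r by (metis imageE)
    qed
  qed
qed

theorem metrizable_imp_mackey:
  fixes \<tau> :: "'a::ab_group_add topology"
  assumes bdd: "bounded_group TYPE('a)" and lqc: "lqc_group_topology \<tau>" and metr: "metrizable_space \<tau>"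
  shows "mackey_topology \<tau>"
  unfolding mackey_topology_def
proof (intro conjI lqc ballI allI impI)
  fix \<nu> U assume \<nu>: "\<nu> \<in> compatible_lqc_topologies \<tau>" and U: "openin \<nu> U"
  have gt: "group_topology \<tau>" and top: "topspace \<tau> = UNIV"
    using lqc by (auto simp: lqc_group_topology_def group_topology_def)
  have \<nu>lqc: "lqc_group_topology \<nu>" and dual: "dual_group \<nu> = dual_group \<tau>"
    using \<nu> by (auto simp: compatible_lqc_topologies_def compatible_def)
  have \<nu>gt: "group_topology \<nu>"
    using \<nu>lqc by (auto simp: lqc_group_topology_def)
  show "openin \<tau> U"
  proof (rule topology_le_if_kern[OF bdd \<nu>lqc gt _ U])
    fix K assume K: "K \<subseteq> dual_group \<nu>" "openin \<nu> (kern K)"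
    then have Kc: "\<And>\<phi>. \<phi> \<in> K \<Longrightarrow> character \<phi>" using dual_group_iff[OF bdd \<nu>gt] by blast
    \<comment> \<open>The annihilator of \<open>kern K\<close> among all characters. As
      \<open>kern K\<close> is open for \<open>\<nu>\<close>, its members are continuous for
      \<open>\<nu>\<close> and, by equality of duals, for \<open>\<tau>\<close>.\<close>
    define Y where "Y = {\<phi>. character \<phi> \<and> kern K \<subseteq> kern {\<phi>}}"
    have Yc: "\<And>\<phi>. \<phi> \<in> Y \<Longrightarrow> character \<phi>" by (simp add: Y_def)
    have Y: "Y \<subseteq> dual_group \<tau>"
      using dual_group_superset_kern[OF bdd \<nu>gt K(2) Kc] by (auto simp: Y_def simp flip: dual)
    have kY: "kern Y = kern K"
      using Kc by (auto simp: Y_def kern_def)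
    show "openin \<tau> (kern K)"
    proof (rule ccontr)
      assume neg: "\<not> openin \<tau> (kern K)"
      obtain B :: "nat \<Rightarrow> 'a set" where B: "\<And>n. openin \<tau> (B n)" "\<And>n. 0 \<in> B n"
          "\<And>V. openin \<tau> V \<Longrightarrow> 0 \<in> V \<Longrightarrow> \<exists>n. B n \<subseteq> V"
        using metrizable_base_at[OF metr, of 0] top by auto
      \<comment> \<open>Every neighborhood of \<open>0\<close> contains some \<open>B n\<close>,
        hence will contain the point \<open>y n\<close> chosen from
        \<open>kern (L n)\<close>.\<close>
      have "\<forall>n. \<exists>L. L \<subseteq> dual_group \<tau> \<and> openin \<tau> (kern L) \<and> kern L \<subseteq> B n"
        using lqc_kern_base[OF bdd lqc B(1,2)] by metis
      then obtain L where L: "\<And>n. L n \<subseteq> dual_group \<tau>" "\<And>n. openin \<tau> (kern (L n))" "\<And>n. kern (L n) \<subseteq> B n"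
        by metis
      have Lc: "\<And>n \<phi>. \<phi> \<in> L n \<Longrightarrow> character \<phi>" using L(1) dual_group_character top by blast
      obtain y \<xi> where y: "\<And>n. y n \<in> kern (L n)" "\<And>n. \<xi> n \<in> Y" "\<And>i j. \<xi> i (y j) = 1 \<longleftrightarrow> i \<noteq> j"
      proof (rule biorthogonal_sequence[OF bdd, of Y "\<lambda>n. kern (L n)"])
        show "\<And>\<phi>. \<phi> \<in> Y \<Longrightarrow> character \<phi>" by (rule Yc)
        show "(\<lambda>_. 1) \<in> Y" by (auto simp: Y_def character_one kern_def)
        show "(\<lambda>x. \<phi> x * \<psi> x) \<in> Y" if "\<phi> \<in> Y" "\<psi> \<in> Y" for \<phi> \<psi>
          using that by (auto simp: Y_def character_mult kern_def subset_iff)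
        show "(\<Sum>i<(j::nat). x) \<in> kern (L n)" if "x \<in> kern (L n)" for n x j
          using kern_multiple[OF Lc that] .
        show "\<not> kern (L n) \<inter> kern C \<subseteq> kern Y" if C: "finite C" "C \<subseteq> Y" for n C
        proof
          \<comment> \<open>Otherwise \<open>kern Y\<close> would contain a
            \<open>\<tau>\<close>-open neighborhood of \<open>0\<close> and be open itself.\<close>
          assume "kern (L n) \<inter> kern C \<subseteq> kern Y"
          moreover have "openin \<tau> (kern (L n) \<inter> kern C)"
            using openin_kern_finite[OF bdd gt C(1)] C Y L(2) by blast
          moreover have "0 \<in> kern (L n) \<inter> kern C"
            using kern_0[of "L n"] kern_0[of C] Lc C Yc by (meson IntI subsetD)
          ultimately have "openin \<tau> (kern Y)" using openin_kern[OF gt Yc] by blast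
          then show False using neg kY by simp
        qed
      qed (rule that)
      obtain \<phi> where \<phi>: "character \<phi>" "kern K \<subseteq> kern {\<phi>}" "\<And>n. \<phi> (y n) = \<xi> n (y n)"
        using biorthogonal_product[of \<xi> y "kern K"] y by (auto simp: Y_def)
      \<comment> \<open>The cluster point still annihilates \<open>kern K\<close>, so it belongs to
        \<open>Y\<close>. Its open kernel must then contain some \<open>y n\<close>, where its value
        is not 1.\<close>
      then have "\<phi> \<in> dual_group \<tau>" using Y by (auto simp: Y_def)
      then have "openin \<tau> (kern {\<phi>})" "0 \<in> kern {\<phi>}"
        using dual_group_iff[OF bdd gt] kern_0[of "{\<phi>}"] by auto
      then obtain n where "B n \<subseteq> kern {\<phi>}" using B(3) by blast
      then have "\<phi> (y n) = 1" using y(1)[of n] L(3)[of n] by (auto simp: kern_def)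
      then show False using \<phi>(3) y(3) by metis
    qed
  qed
qed

section \<open>Precompact topologies\<close>

text \<open>Precompactness gives \<open>kern K\<close> finite index, so finitely many members of
  \<open>K\<close> already cut it out, and a finite intersection of kernels of common characters is
  open for \<open>\<nu>\<close>.\<close>

lemma precompact_le_compatible:
  fixes \<tau> \<nu> :: "'a::ab_group_add topology"
  assumes bdd: "bounded_group TYPE('a)" and lqc: "lqc_group_topology \<tau>" and pre: "precompact_topology \<tau>"
    and \<nu>: "group_topology \<nu>" "dual_group \<nu> = dual_group \<tau>" and U: "openin \<tau> U"
  shows "openin \<nu> U"
proof (rule topology_le_if_kern[OF bdd lqc \<nu>(1) _ U])
  fix K assume K: "K \<subseteq> dual_group \<tau>" "openin \<tau> (kern K)"
  then have Kc: "\<And>\<phi>. \<phi> \<in> K \<Longrightarrow> character \<phi>" using dual_group_iff[OF bdd \<nu>(1)] \<nu>(2) by blast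
  have "0 \<in> kern K" by (rule kern_0[OF Kc])
  with K(2) obtain F where F: "finite F" "{f + u |f u. f \<in> F \<and> u \<in> kern K} = UNIV"
    using pre[unfolded precompact_topology_def, THEN conjunct2, rule_format, of "kern K"] by blast
  \<comment> \<open>\<open>g f\<close> will witness \<open>f \<notin> kern K\<close>; one witness
    per element of \<open>F\<close> outside \<open>kern K\<close> is enough.\<close>
  have "\<forall>f. \<exists>\<phi>. f \<notin> kern K \<longrightarrow> \<phi> \<in> K \<and> \<phi> f \<noteq> 1" by (auto simp: kern_def)
  then obtain g where g: "\<And>f. f \<notin> kern K \<Longrightarrow> g f \<in> K \<and> g f f \<noteq> 1" by metis
  define C where "C = g ` (F - kern K)"
  have C: "finite C" "C \<subseteq> K" using F g by (auto simp: C_def)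
  have "kern C \<subseteq> kern K"
  proof
    fix x assume x: "x \<in> kern C"
    obtain f u where fu: "f \<in> F" "u \<in> kern K" "x = f + u" using F(2) by blast
    have "f \<in> kern K"
    proof (rule ccontr)
      assume f: "f \<notin> kern K"
      then have "g f x = 1" using x fu by (auto simp: C_def kern_def)
      moreover have "g f x = g f f * g f u" using g[OF f] Kc fu character_add by metis
      moreover have "g f u = 1" using g[OF f] fu by (auto simp: kern_def)
      ultimately show False using g[OF f] by simp
    qed
    then show "x \<in> kern K" using kern_add[OF Kc] fu by blast
  qed
  then show "openin \<nu> (kern K)"
    using openin_kern[OF \<nu>(1) Kc openin_kern_finite[OF bdd \<nu>(1) C(1)] kern_0] C K \<nu>(2) Kc by blast
qed

text \<open>The Mackey property bounds the compatible topologies from above, precompactness bounds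
  them from below.\<close>

lemma precompact_compatible_unique:
  fixes \<tau> :: "'a::ab_group_add topology"
  assumes bdd: "bounded_group TYPE('a)" and lqc: "lqc_group_topology \<tau>" and metr: "metrizable_space \<tau>"
    and pre: "precompact_topology \<tau>"
  shows "compatible_lqc_topologies \<tau> = {\<tau>}"
proof -
  have "\<nu> = \<tau>" if \<nu>: "\<nu> \<in> compatible_lqc_topologies \<tau>" for \<nu>
    unfolding topology_eq
  proof (intro allI iffI)
    show "openin \<tau> U" if "openin \<nu> U" for U
      using metrizable_imp_mackey[OF bdd lqc metr] \<nu> that by (auto simp: mackey_topology_def)
    show "openin \<nu> U" if "openin \<tau> U" for U
      using precompact_le_compatible[OF bdd lqc pre _ _ that] \<nu>
      by (auto simp: compatible_lqc_topologies_def lqc_group_topology_def compatible_def)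
  qed
  then show ?thesis
    using lqc by (auto simp: compatible_lqc_topologies_def compatible_def)
qed

section \<open>Topologies generated by kernels\<close>

text \<open>For sets of characters, this is the group topology with the subgroups
  \<open>kern K\<close>, \<open>K \<in> \<K>\<close>, as subbase at \<open>0\<close>. The empty
  \<open>F\<close> gives the whole group.\<close>

definition kernel_topology :: "('a::ab_group_add \<Rightarrow> complex) set set \<Rightarrow> 'a topology" where
  "kernel_topology \<K> = topology (\<lambda>U. \<forall>x\<in>U. \<exists>F. finite F \<and> F \<subseteq> \<K> \<and> (\<forall>y. y - x \<in> kern (\<Union>F) \<longrightarrow> y \<in> U))"

lemma openin_kernel_topology:
  "openin (kernel_topology \<K>) U \<longleftrightarrow>
    (\<forall>x\<in>U. \<exists>F. finite F \<and> F \<subseteq> \<K> \<and> (\<forall>y. y - x \<in> kern (\<Union>F) \<longrightarrow> y \<in> U))"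
proof -
  have "istopology (\<lambda>U. \<forall>x\<in>U. \<exists>F. finite F \<and> F \<subseteq> \<K> \<and> (\<forall>y. y - x \<in> kern (\<Union>F) \<longrightarrow> y \<in> U))"
    (is "istopology ?P")
    unfolding istopology_def
  proof (intro conjI allI impI)
    fix S T assume ST: "?P S" "?P T"
    show "?P (S \<inter> T)"
    proof
      fix x assume "x \<in> S \<inter> T"
      then obtain F F' where "finite F" "F \<subseteq> \<K>" "\<forall>y. y - x \<in> kern (\<Union>F) \<longrightarrow> y \<in> S"
          "finite F'" "F' \<subseteq> \<K>" "\<forall>y. y - x \<in> kern (\<Union>F') \<longrightarrow> y \<in> T"
        using bspec[OF ST(1), of x] bspec[OF ST(2), of x] by auto
      then show "\<exists>F. finite F \<and> F \<subseteq> \<K> \<and> (\<forall>y. y - x \<in> kern (\<Union>F) \<longrightarrow> y \<in> S \<inter> T)"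
        by (intro exI[of _ "F \<union> F'"]) (auto simp: kern_Un)
    qed
  next
    fix \<U> assume \<U>: "\<forall>U\<in>\<U>. ?P U"
    show "?P (\<Union>\<U>)"
    proof
      fix x assume "x \<in> \<Union>\<U>"
      then obtain U where U: "U \<in> \<U>" "x \<in> U" by blast
      then obtain F where "finite F" "F \<subseteq> \<K>" "\<forall>y. y - x \<in> kern (\<Union>F) \<longrightarrow> y \<in> U"
        using bspec[OF bspec[OF \<U> U(1)] U(2)] by auto
      then show "\<exists>F. finite F \<and> F \<subseteq> \<K> \<and> (\<forall>y. y - x \<in> kern (\<Union>F) \<longrightarrow> y \<in> \<Union>\<U>)"
        using U(1) by (intro exI[of _ F]) auto
    qed
  qed
  then show ?thesis
    by (simp add: kernel_topology_def)
qed

lemma openin_kernel_topology_kern: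
  assumes "\<And>K \<phi>. K \<in> \<K> \<Longrightarrow> \<phi> \<in> K \<Longrightarrow> character \<phi>" "finite F" "F \<subseteq> \<K>"
  shows "openin (kernel_topology \<K>) {y. y - x \<in> kern (\<Union>F)}"
  unfolding openin_kernel_topology
proof (intro ballI exI[of _ F] conjI allI impI assms(2,3))
  fix z y assume zy: "z \<in> {y. y - x \<in> kern (\<Union>F)}" "y - z \<in> kern (\<Union>F)"
  have "(y - z) + (z - x) \<in> kern (\<Union>F)"
    using zy assms by (intro kern_add) auto
  then show "y \<in> {y. y - x \<in> kern (\<Union>F)}" by simp
qed

lemma group_topology_kernel_topology:
  assumes "\<And>K \<phi>. K \<in> \<K> \<Longrightarrow> \<phi> \<in> K \<Longrightarrow> character \<phi>"
  shows "group_topology (kernel_topology \<K>)"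
proof -
  let ?T = "kernel_topology \<K>"
  have c: "character \<phi>" if "F \<subseteq> \<K>" "\<phi> \<in> \<Union>F" for F \<phi>
    using assms that by blast
  have "openin ?T UNIV" unfolding openin_kernel_topology by (auto intro: exI[of _ "{}"])
  then have top: "topspace ?T = UNIV" by (metis openin_subset top.extremum_uniqueI)
  have "continuous_map (prod_topology ?T ?T) ?T (\<lambda>(x, y). x + y)"
    unfolding continuous_map_def
  proof (intro conjI allI impI)
    fix U assume U: "openin ?T U"
    show "openin (prod_topology ?T ?T) {p \<in> topspace (prod_topology ?T ?T). (case p of (x, y) \<Rightarrow> x + y) \<in> U}"
      unfolding openin_prod_topology_alt
    proof (intro allI impI)
      fix x y assume "(x, y) \<in> {p \<in> topspace (prod_topology ?T ?T). (case p of (x, y) \<Rightarrow> x + y) \<in> U}"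
      then have "x + y \<in> U" by simp
      then obtain F where F: "finite F" "F \<subseteq> \<K>" "\<And>z. z - (x + y) \<in> kern (\<Union>F) \<Longrightarrow> z \<in> U"
        using U unfolding openin_kernel_topology by meson
      have "u + v \<in> U" if "u - x \<in> kern (\<Union>F)" "v - y \<in> kern (\<Union>F)" for u v
        using kern_add[OF c that] F by (simp add: algebra_simps)
      moreover have "0 \<in> kern (\<Union>F)" using c F by (intro kern_0) auto
      ultimately show "\<exists>V W. openin ?T V \<and> openin ?T W \<and> x \<in> V \<and> y \<in> W \<and>
          V \<times> W \<subseteq> {p \<in> topspace (prod_topology ?T ?T). (case p of (x, y) \<Rightarrow> x + y) \<in> U}"
        using openin_kernel_topology_kern[OF assms F(1,2)]
        by (intro exI[of _ "{u. u - x \<in> kern (\<Union>F)}"] exI[of _ "{u. u - y \<in> kern (\<Union>F)}"])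
          (auto simp: top)
    qed
  qed (auto simp: top)
  moreover have "continuous_map ?T ?T uminus"
    unfolding continuous_map_def
  proof (intro conjI allI impI)
    fix U assume U: "openin ?T U"
    show "openin ?T {x \<in> topspace ?T. - x \<in> U}"
      unfolding openin_kernel_topology
    proof
      fix x assume "x \<in> {x \<in> topspace ?T. - x \<in> U}"
      then obtain F where F: "finite F" "F \<subseteq> \<K>" "\<And>z. z - (- x) \<in> kern (\<Union>F) \<Longrightarrow> z \<in> U"
        using U unfolding openin_kernel_topology by blast
      have "- y \<in> U" if "y - x \<in> kern (\<Union>F)" for y
        using kern_minus[OF c that] F by simp
      then show "\<exists>F. finite F \<and> F \<subseteq> \<K> \<and> (\<forall>y. y - x \<in> kern (\<Union>F) \<longrightarrow> y \<in> {x \<in> topspace ?T. - x \<in> U})"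
        using F(1,2) top by auto
    qed
  qed (auto simp: top)
  ultimately show ?thesis using top by (simp add: group_topology_def)
qed

text \<open>The singletons make all characters of \<open>\<tau>\<close> continuous and yield the
  Hausdorff property. No further character appears, since every basic subgroup is open for
  \<open>\<tau>\<close>.\<close>

lemma kernel_topology_compatible:
  fixes \<tau> :: "'a::ab_group_add topology"
  assumes bdd: "bounded_group TYPE('a)" and lqc: "lqc_group_topology \<tau>"
    and \<K>: "\<And>K. K \<in> \<K> \<Longrightarrow> K \<subseteq> dual_group \<tau>" "\<And>K. K \<in> \<K> \<Longrightarrow> openin \<tau> (kern K)"
    and single: "\<And>\<phi>. \<phi> \<in> dual_group \<tau> \<Longrightarrow> {\<phi>} \<in> \<K>"
  shows "kernel_topology \<K> \<in> compatible_lqc_topologies \<tau>"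
proof -
  let ?T = "kernel_topology \<K>"
  have gt: "group_topology \<tau>" and top: "topspace \<tau> = UNIV"
    using lqc by (auto simp: lqc_group_topology_def group_topology_def)
  have c: "\<And>K \<phi>. K \<in> \<K> \<Longrightarrow> \<phi> \<in> K \<Longrightarrow> character \<phi>"
    using \<K>(1) dual_group_character top by blast
  have Tgt: "group_topology ?T" by (rule group_topology_kernel_topology[OF c])
  then have Ttop: "topspace ?T = UNIV" by (simp add: group_topology_def)
  have open_kern: "openin ?T (kern (\<Union>F))" if "finite F" "F \<subseteq> \<K>" for F
    using openin_kernel_topology_kern[OF c that, where x = 0] by simp
  have coarser: "openin \<tau> (kern (\<Union>F))" if "finite F" "F \<subseteq> \<K>" for F
    using that
  proof (induction F rule: finite_induct)
    case empty
    have "kern (\<Union>{}) = topspace \<tau>" using top by (simp add: kern_def)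
    then show ?case by simp
  next
    case (insert K F)
    then show ?case using \<K>(2) by (auto simp: kern_Un)
  qed
  have dual: "dual_group ?T = dual_group \<tau>"
  proof
    show "dual_group \<tau> \<subseteq> dual_group ?T"
      using open_kern[of "{{_}}"] single dual_group_iff[OF bdd Tgt] dual_group_iff[OF bdd gt] by auto
    show "dual_group ?T \<subseteq> dual_group \<tau>"
    proof
      fix \<phi> assume "\<phi> \<in> dual_group ?T"
      then have \<phi>: "character \<phi>" "openin ?T (kern {\<phi>})" using dual_group_iff[OF bdd Tgt] by auto
      then have "0 \<in> kern {\<phi>}" by (intro kern_0) auto
      then obtain F where F: "finite F" "F \<subseteq> \<K>" "\<And>y. y - 0 \<in> kern (\<Union>F) \<Longrightarrow> y \<in> kern {\<phi>}"
        using \<phi>(2) unfolding openin_kernel_topology by meson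
      show "\<phi> \<in> dual_group \<tau>"
        by (rule dual_group_superset_kern[OF bdd gt coarser[OF F(1,2)] _ \<phi>(1)]) (use c F in auto)
    qed
  qed
  have "Hausdorff_space ?T"
    unfolding Hausdorff_space_def
  proof (intro allI impI)
    fix x y assume "x \<in> topspace ?T \<and> y \<in> topspace ?T \<and> x \<noteq> y"
    then have "y - x \<noteq> 0" by auto
    then obtain \<phi> where \<phi>: "\<phi> \<in> dual_group \<tau>" "\<phi> (y - x) \<noteq> 1"
      using dual_group_separates[OF bdd lqc] by metis
    have ch: "character \<phi>" using \<phi>(1) dual_group_character top by blast
    have "openin ?T {z. z - x \<in> kern (\<Union>{{\<phi>}})}" "openin ?T {z. z - y \<in> kern (\<Union>{{\<phi>}})}"
      by (rule openin_kernel_topology_kern[OF c]; use single \<phi> in simp)+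
    moreover have "disjnt {z. z - x \<in> kern (\<Union>{{\<phi>}})} {z. z - y \<in> kern (\<Union>{{\<phi>}})}"
      using \<phi>(2) by (auto simp: disjnt_def kern_def character_diff_eq_1[OF ch])
    ultimately show "\<exists>U V. openin ?T U \<and> openin ?T V \<and> x \<in> U \<and> y \<in> V \<and> disjnt U V"
      by (intro exI[of _ "{z. z - x \<in> kern (\<Union>{{\<phi>}})}"] exI[of _ "{z. z - y \<in> kern (\<Union>{{\<phi>}})}"])
        (auto simp: kern_def character_0[OF ch])
  qed
  moreover have "neighbourhood_base_at 0 (quasi_convex ?T) ?T"
    unfolding neighbourhood_base_at_def
  proof (intro allI impI)
    fix W assume W: "openin ?T W \<and> 0 \<in> W"
    then obtain F where F: "finite F" "F \<subseteq> \<K>" "\<And>y. y - 0 \<in> kern (\<Union>F) \<Longrightarrow> y \<in> W"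
      unfolding openin_kernel_topology by meson
    have "quasi_convex ?T (kern (\<Union>F))"
      unfolding quasi_convex_def
    proof (intro allI impI)
      fix x assume "x \<notin> kern (\<Union>F)"
      then obtain \<phi> where \<phi>: "\<phi> \<in> \<Union>F" "\<phi> x \<noteq> 1" by (auto simp: kern_def)
      then have \<phi>d: "\<phi> \<in> dual_group ?T" using F \<K>(1) dual by blast
      then have ch: "character \<phi>" using dual_group_character Ttop by blast
      obtain m :: nat where m: "m > 0" "\<And>(\<phi>::'a \<Rightarrow> complex) x. character \<phi> \<Longrightarrow> \<phi> x ^ m = 1"
        using bounded_group_root_of_unity[OF bdd] by blast
      \<comment> \<open>\<open>\<phi> x \<noteq> 1\<close> alone may leave \<open>\<phi> x\<close>
        in \<open>circle_plus\<close>; a suitable power moves it out while remaining 1 on the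
        subgroup.\<close>
      obtain j where j: "\<phi> x ^ j \<notin> circle_plus"
        using circle_plus_powers_imp_1[OF m(2)[OF ch] m(1)] \<phi>(2) by blast
      have "(\<lambda>x. \<phi> x ^ j) \<in> dual_group ?T"
        using dual_group_power[OF bdd Tgt \<phi>d] .
      moreover have "(\<lambda>x. \<phi> x ^ j) ` kern (\<Union>F) \<subseteq> circle_plus"
      proof -
        have "\<phi> z = 1" if "z \<in> kern (\<Union>F)" for z
          using \<phi>(1) that unfolding kern_def by blast
        then show ?thesis by (auto simp: circle_plus_def)
      qed
      ultimately show "\<exists>\<phi>\<in>dual_group ?T. \<phi> ` kern (\<Union>F) \<subseteq> circle_plus \<and> \<phi> x \<notin> circle_plus"
        using j by (intro bexI[of _ "\<lambda>x. \<phi> x ^ j"]) auto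
    qed
    moreover have "0 \<in> kern (\<Union>F)" using c F by (intro kern_0) auto
    ultimately show "\<exists>U V. openin ?T U \<and> quasi_convex ?T V \<and> 0 \<in> U \<and> U \<subseteq> V \<and> V \<subseteq> W"
      using open_kern[OF F(1,2)] F(3) by (intro exI[of _ "kern (\<Union>F)"]) auto
  qed
  ultimately show ?thesis
    using Tgt dual by (simp add: compatible_lqc_topologies_def lqc_group_topology_def compatible_def)
qed

section \<open>Many compatible topologies\<close>

text \<open>Graphs of \<open>n \<mapsto> \<lfloor>r n\<rfloor>\<close> for distinct slopes eventually separate.\<close>

definition slope_set :: "real \<Rightarrow> nat set" where
  "slope_set r = range (\<lambda>n::nat. to_nat (n, \<lfloor>r * real n\<rfloor>))"

lemma infinite_slope_set: "infinite (slope_set r)"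
  unfolding slope_set_def by (rule range_inj_infinite) (auto intro!: injI)

lemma slope_set_almost_disjoint:
  assumes "r \<noteq> s"
  shows "finite (slope_set r \<inter> slope_set s)"
proof -
  have "slope_set r \<inter> slope_set s \<subseteq> (\<lambda>n. to_nat (n, \<lfloor>r * real n\<rfloor>)) ` {n. real n \<le> 1 / \<bar>r - s\<bar>}"
  proof
    fix k assume "k \<in> slope_set r \<inter> slope_set s"
    \<comment> \<open>\<open>to_nat\<close> is injective, so a common code has the same
      \<open>n\<close> on both graphs.\<close>
    then obtain n where n: "k = to_nat (n, \<lfloor>r * real n\<rfloor>)" "\<lfloor>r * real n\<rfloor> = \<lfloor>s * real n\<rfloor>"
      by (auto simp: slope_set_def)
    then have "\<bar>r * real n - s * real n\<bar> < 1" by linarith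
    then have "\<bar>r - s\<bar> * real n < 1" by (simp add: abs_mult flip: left_diff_distrib)
    then have "real n \<le> 1 / \<bar>r - s\<bar>" using assms by (simp add: field_simps)
    then show "k \<in> (\<lambda>n. to_nat (n, \<lfloor>r * real n\<rfloor>)) ` {n. real n \<le> 1 / \<bar>r - s\<bar>}"
      using n(1) by blast
  qed
  moreover have "finite {n. real n \<le> 1 / \<bar>r - s\<bar>}"
    by (rule finite_subset[of _ "{..nat \<lfloor>1 / \<bar>r - s\<bar>\<rfloor>}"]) (auto simp: le_nat_floor)
  ultimately show ?thesis by (meson finite_imageI finite_subset)
qed

text \<open>If \<open>A - B\<close> is infinite, pigeonhole gives distinct \<open>k\<close>,
  \<open>l\<close> in it such that \<open>y k\<close> and \<open>y l\<close> agree on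
  \<open>C\<close>. Their difference is killed by \<open>C\<close> and by all \<open>\<xi> b\<close>
  with \<open>b \<in> B\<close>, but not by \<open>\<xi> k\<close>.\<close>

lemma kern_almost_disjoint:
  fixes y :: "nat \<Rightarrow> 'a::ab_group_add"
  assumes bdd: "bounded_group TYPE('a)" and C: "finite C" "\<And>\<phi>. \<phi> \<in> C \<Longrightarrow> character \<phi>"
    and \<xi>: "\<And>n. character (\<xi> n)" "\<And>i j. \<xi> i (y j) = 1 \<longleftrightarrow> i \<noteq> j"
    and sub: "kern (C \<union> \<xi> ` B) \<subseteq> kern (\<xi> ` A)"
  shows "finite (A - B)"
proof (rule ccontr)
  assume inf: "infinite (A - B)"
  have "finite ((\<lambda>k. \<lambda>\<phi>\<in>C. \<phi> (y k)) ` (A - B))"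
    by (rule finite_subset[OF _ finite_range_of_characters[OF bdd C]]) auto
  then have "\<not> inj_on (\<lambda>k. \<lambda>\<phi>\<in>C. \<phi> (y k)) (A - B)"
    using inf finite_imageD by blast
  then obtain k l where kl: "k \<in> A - B" "l \<in> A - B" "k \<noteq> l" "(\<lambda>\<phi>\<in>C. \<phi> (y k)) = (\<lambda>\<phi>\<in>C. \<phi> (y l))"
    by (auto simp: inj_on_def)
  have "\<phi> (y k - y l) = 1" if "\<phi> \<in> C" for \<phi>
    using fun_cong[OF kl(4), of \<phi>] that C(2) by (simp add: character_diff_eq_1)
  moreover have "\<xi> b (y k - y l) = 1" if "b \<in> B" for b
    using kl that \<xi> by (metis DiffE character_diff_eq_1)
  ultimately have "y k - y l \<in> kern (C \<union> \<xi> ` B)"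
    by (auto simp: kern_def)
  then have "y k - y l \<in> kern (\<xi> ` A)"
    using sub by blast
  then have "\<xi> k (y k - y l) = 1" using kl by (auto simp: kern_def)
  then show False using \<xi> kl(3) by (metis character_diff_eq_1)
qed

lemma many_compatible_topologies:
  fixes \<tau> :: "'a::ab_group_add topology"
  assumes bdd: "bounded_group TYPE('a)" and lqc: "lqc_group_topology \<tau>" and npre: "\<not> precompact_topology \<tau>"
  shows "(UNIV :: real set set) \<lesssim> compatible_lqc_topologies \<tau>"
proof -
  have gt: "group_topology \<tau>" and top: "topspace \<tau> = UNIV"
    using lqc by (auto simp: lqc_group_topology_def group_topology_def)
  let ?X = "dual_group \<tau>"
  have Xc: "\<And>\<phi>. \<phi> \<in> ?X \<Longrightarrow> character \<phi>" using dual_group_character top by blast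
  have "\<exists>U. (openin \<tau> U \<and> 0 \<in> U) \<and> \<not> (\<exists>F. finite F \<and> {f + u |f u. f \<in> F \<and> u \<in> U} = UNIV)"
    using npre gt by (simp add: precompact_topology_def)
  then obtain U where "(openin \<tau> U \<and> 0 \<in> U) \<and> \<not> (\<exists>F. finite F \<and> {f + u |f u. f \<in> F \<and> u \<in> U} = UNIV)" ..
  then have U: "openin \<tau> U" "0 \<in> U" "\<not> (\<exists>F. finite F \<and> {f + u |f u. f \<in> F \<and> u \<in> U} = UNIV)"
    by simp_all
  obtain K where K: "K \<subseteq> ?X" "openin \<tau> (kern K)" "kern K \<subseteq> U"
    using lqc_kern_base[OF bdd lqc U(1,2)] by blast
  define Y where "Y = {\<phi> \<in> ?X. kern K \<subseteq> kern {\<phi>}}"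
  have kY: "kern Y = kern K" using K(1) by (auto simp: Y_def kern_def)
  obtain y :: "nat \<Rightarrow> 'a" and \<xi> where y: "\<And>n. \<xi> n \<in> Y" "\<And>i j. \<xi> i (y j) = 1 \<longleftrightarrow> i \<noteq> j"
  proof (rule biorthogonal_sequence[OF bdd, of Y "\<lambda>n. UNIV"])
    show "\<And>\<phi>. \<phi> \<in> Y \<Longrightarrow> character \<phi>" using Xc by (simp add: Y_def)
    show "(\<lambda>_. 1) \<in> Y" by (auto simp: Y_def dual_group_one gt kern_def)
    show "(\<lambda>x. \<phi> x * \<psi> x) \<in> Y" if "\<phi> \<in> Y" "\<psi> \<in> Y" for \<phi> \<psi>
      using that by (auto simp: Y_def kern_def dual_group_mult bdd gt subset_iff)
    show "\<not> UNIV \<inter> kern C \<subseteq> kern Y" if C: "finite C" "C \<subseteq> Y" for C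
    proof
      \<comment> \<open>Then \<open>kern C\<close> would be a subgroup of finite index inside
        \<open>U\<close>, and finitely many translates of \<open>U\<close> would cover the
        group.\<close>
      assume *: "UNIV \<inter> kern C \<subseteq> kern Y"
      obtain F where F: "finite F" "\<And>x. \<exists>f\<in>F. x - f \<in> kern C"
        using finite_index_kern[OF bdd C(1)] C(2) Xc Y_def by (metis (no_types, lifting) mem_Collect_eq subsetD)
      have "x \<in> {f + u |f u. f \<in> F \<and> u \<in> U}" for x
      proof -
        obtain f where "f \<in> F" "x - f \<in> kern C" using F(2) by blast
        moreover have "x - f \<in> U" using calculation * kY K(3) by blast
        moreover have "x = f + (x - f)" by simp
        ultimately show ?thesis by blast
      qed
      then have "{f + u |f u. f \<in> F \<and> u \<in> U} = UNIV" by blast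
      then show False using U(3) F(1) by simp
    qed
    show "(\<Sum>i<(j::nat). x) \<in> UNIV" for x :: 'a and j by simp
  qed (rule that)
  have \<xi>X: "\<And>n. \<xi> n \<in> ?X" and \<xi>K: "\<And>n. kern K \<subseteq> kern {\<xi> n}" using y(1) by (auto simp: Y_def)
  \<comment> \<open>The singletons generate the weak topology of the dual; each
    \<open>r \<in> S\<close> adds the subgroup attached to \<open>slope_set r\<close>.\<close>
  define \<K> where "\<K> S = (\<lambda>\<phi>. {\<phi>}) ` ?X \<union> (\<lambda>r. \<xi> ` slope_set r) ` S" for S
  have comp: "kernel_topology (\<K> S) \<in> compatible_lqc_topologies \<tau>" for S
  proof (rule kernel_topology_compatible[OF bdd lqc])
    fix L assume L: "L \<in> \<K> S"
    show LX: "L \<subseteq> ?X" using L \<xi>X by (auto simp: \<K>_def)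
    show "openin \<tau> (kern L)"
    proof (cases "L \<in> (\<lambda>\<phi>. {\<phi>}) ` ?X")
      case True
      then show ?thesis using dual_group_iff[OF bdd gt] by auto
    next
      case False
      then obtain r where "L = \<xi> ` slope_set r" using L by (auto simp: \<K>_def)
      then have "kern K \<subseteq> kern L" using \<xi>K by (auto simp: kern_def)
      then show ?thesis using openin_kern[OF gt _ K(2) kern_0] LX K(1) Xc by blast
    qed
  qed (simp add: \<K>_def)
  \<comment> \<open>Injectivity in inclusion form: \<open>r\<close> lies in \<open>S'\<close> as
    soon as the subgroup attached to \<open>slope_set r\<close> is open in the topology of
    \<open>S'\<close>.\<close>
  have sub: "S \<subseteq> S'" if eq: "kernel_topology (\<K> S) = kernel_topology (\<K> S')" for S S'
  proof
    fix r assume r: "r \<in> S"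
    have \<K>c: "\<And>S L \<phi>. L \<in> \<K> S \<Longrightarrow> \<phi> \<in> L \<Longrightarrow> character \<phi>"
      using Xc \<xi>X by (auto simp: \<K>_def)
    have "openin (kernel_topology (\<K> S)) {y. y - 0 \<in> kern (\<Union>{\<xi> ` slope_set r})}"
      by (rule openin_kernel_topology_kern) (use r \<K>c in \<open>auto simp: \<K>_def\<close>)
    then have "openin (kernel_topology (\<K> S')) (kern (\<xi> ` slope_set r))" by (simp add: eq)
    moreover have "0 \<in> kern (\<xi> ` slope_set r)" using \<xi>X Xc by (intro kern_0) auto
    ultimately obtain F where F: "finite F" "F \<subseteq> \<K> S'"
        "\<And>z. z - 0 \<in> kern (\<Union>F) \<Longrightarrow> z \<in> kern (\<xi> ` slope_set r)"
      unfolding openin_kernel_topology by meson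
    \<comment> \<open>\<open>F\<close> splits into finitely many singletons, indexed by
      \<open>C\<close>, and finitely many slope families, indexed by \<open>R\<close>.\<close>
    obtain C where C: "C \<subseteq> ?X" "finite C" "F \<inter> (\<lambda>\<phi>. {\<phi>}) ` ?X = (\<lambda>\<phi>. {\<phi>}) ` C"
      using finite_subset_image[of "F \<inter> (\<lambda>\<phi>. {\<phi>}) ` ?X" "\<lambda>\<phi>. {\<phi>}" ?X] F(1) by auto
    have "\<exists>R\<subseteq>S'. finite R \<and> F \<inter> (\<lambda>r. \<xi> ` slope_set r) ` S' = (\<lambda>r. \<xi> ` slope_set r) ` R"
      using F(1) by (intro finite_subset_image) simp_all
    then obtain R where
      "R \<subseteq> S' \<and> finite R \<and> F \<inter> (\<lambda>r. \<xi> ` slope_set r) ` S' = (\<lambda>r. \<xi> ` slope_set r) ` R" ..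
    then have R: "R \<subseteq> S'" "finite R"
        "F \<inter> (\<lambda>r. \<xi> ` slope_set r) ` S' = (\<lambda>r. \<xi> ` slope_set r) ` R"
      by (simp_all only:)
    have "F = F \<inter> (\<lambda>\<phi>. {\<phi>}) ` ?X \<union> F \<inter> (\<lambda>r. \<xi> ` slope_set r) ` S'"
      using F(2) unfolding \<K>_def Int_Un_distrib[symmetric] by (simp add: inf.absorb1)
    then have "F = (\<lambda>\<phi>. {\<phi>}) ` C \<union> (\<lambda>r. \<xi> ` slope_set r) ` R"
      unfolding C(3) R(3) .
    then have "\<Union>F = C \<union> \<xi> ` (\<Union>s\<in>R. slope_set s)" by auto
    then have "kern (C \<union> \<xi> ` (\<Union>s\<in>R. slope_set s)) \<subseteq> kern (\<xi> ` slope_set r)"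
      using F(3) by auto
    then have fin: "finite (slope_set r - (\<Union>s\<in>R. slope_set s))"
      using kern_almost_disjoint[OF bdd C(2)] C(1) Xc \<xi>X y(2) by blast
    show "r \<in> S'"
    proof (rule ccontr)
      \<comment> \<open>Every \<open>s \<in> R\<close> then differs from \<open>r\<close>, so
        finitely many finite overlaps and a finite remainder would exhaust
        \<open>slope_set r\<close>.\<close>
      assume "r \<notin> S'"
      then have "finite (\<Union>s\<in>R. slope_set r \<inter> slope_set s)"
        using R(1,2) by (intro finite_UN_I slope_set_almost_disjoint) auto
      then have "finite ((slope_set r - (\<Union>s\<in>R. slope_set s)) \<union> (\<Union>s\<in>R. slope_set r \<inter> slope_set s))"
        using fin by simp
      moreover have "slope_set r \<subseteq> (slope_set r - (\<Union>s\<in>R. slope_set s)) \<union> (\<Union>s\<in>R. slope_set r \<inter> slope_set s)"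
        by blast
      ultimately show False using infinite_slope_set finite_subset by blast
    qed
  qed
  have "inj (\<lambda>S. kernel_topology (\<K> S))"
    by (rule injI) (metis sub subset_antisym)
  then show ?thesis using comp unfolding lepoll_def by blast
qed

text \<open>As \<open>card\<close> is 0 on infinite sets, \<open>card = 1\<close> means a singleton
  and \<open>card \<noteq> 1\<close> includes the infinite case. The lower bound is stated as an
  injection from the sets of reals.\<close>

theorem corollaryB1:
  fixes \<tau> :: "'a::ab_group_add topology"
  assumes "lqc_group_topology \<tau>"
    and "metrizable_space \<tau>"
    and "bounded_group TYPE('a)"
  shows "(card (compatible_lqc_topologies \<tau>) = 1 \<longleftrightarrow> precompact_topology \<tau>) \<and>
         (card (compatible_lqc_topologies \<tau>) = 1 \<longrightarrow>
            precompact_topology \<tau> \<and> mackey_topology \<tau>) \<and>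
         (card (compatible_lqc_topologies \<tau>) \<noteq> 1 \<longrightarrow>
            (UNIV :: real set set) \<lesssim> compatible_lqc_topologies \<tau> \<and>
            {\<nu> \<in> compatible_lqc_topologies \<tau>. metrizable_space \<nu>} = {\<tau>})"
proof -
  have pre: "card (compatible_lqc_topologies \<tau>) = 1" if "precompact_topology \<tau>"
    using precompact_compatible_unique[OF assms(3,1,2) that] by simp
  have many: "(UNIV :: real set set) \<lesssim> compatible_lqc_topologies \<tau>" if "\<not> precompact_topology \<tau>"
    using many_compatible_topologies[OF assms(3,1) that] .
  have "precompact_topology \<tau>" if one: "card (compatible_lqc_topologies \<tau>) = 1"
  proof (rule ccontr)
    assume "\<not> precompact_topology \<tau>"
    then obtain f :: "real set \<Rightarrow> 'a topology" where "inj f" "range f \<subseteq> compatible_lqc_topologies \<tau>"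
      using many by (auto simp: lepoll_def)
    moreover obtain \<nu> where "compatible_lqc_topologies \<tau> = {\<nu>}"
      using one card_1_singletonE by blast
    ultimately have "f {} = \<nu>" "f UNIV = \<nu>" by auto
    then have "f {} = f UNIV" by simp
    then show False using \<open>inj f\<close> by (auto dest: injD)
  qed
  moreover have mackey: "mackey_topology \<tau>"
    using metrizable_imp_mackey[OF assms(3,1,2)] .
  moreover have "\<nu> = \<tau>" if \<nu>: "\<nu> \<in> compatible_lqc_topologies \<tau>" "metrizable_space \<nu>" for \<nu>
  proof -
    \<comment> \<open>Both topologies are Mackey and compatible with each other, so each is finer
      than the other.\<close>
    have "mackey_topology \<nu>"
      using metrizable_imp_mackey[OF assms(3) _ \<nu>(2)] \<nu>(1) by (simp add: compatible_lqc_topologies_def)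
    then show ?thesis
      using mackey \<nu>(1) assms(1)
      by (auto simp: mackey_topology_def topology_eq compatible_lqc_topologies_def compatible_def)
  qed
  moreover have "\<tau> \<in> compatible_lqc_topologies \<tau>"
    using assms(1) by (simp add: compatible_lqc_topologies_def compatible_def)
  ultimately show ?thesis using pre many assms(2) by auto
qed

end
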